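(* For every positive integer $k$ there exist a group word $w$ and a finite simple group $G$ such that $w$ is not an identity in $G$ (i.e. $G_w \neq \{1\}$), but $G \neq (G_w)^k$.
   Context: A group word $w$ is an element of the free group on some finite set of generators $x_1,\ldots,x_d$. For a group $G$, the set of values of $w$ is $G_w := \{ w(g_1,\ldots,g_d)^{\pm 1} : g_1,\ldots,g_d \in G\}$. For a subset $S$ of $G$ and a positive integer $k$, $S^k := \{s_1 s_2 \cdots s_k : s_1,\ldots,s_k \in S\}$ denotes the set of products of $k$ elements of $S$. *)

theory Defs
  imports "HOL-Algebra.Algebra"
begin

text \<open>
  The free group on a set \<open>A\<close>, realised by reduced words. The letter \<open>(x, True)\<close> stands for the
  generator \<open>x\<close> and \<open>(x, False)\<close> for its formal inverse. The product is concatenation followed by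
  cancellation.
\<close>

type_synonym 'x letter = "'x \<times> bool"

definition inv_letter :: "'x letter \<Rightarrow> 'x letter" where
  "inv_letter a = (fst a, \<not> snd a)"

definition reduced :: "'x letter list \<Rightarrow> bool" where
  "reduced w \<longleftrightarrow> successively (\<lambda>a b. b \<noteq> inv_letter a) w"

fun push_letter :: "'x letter \<Rightarrow> 'x letter list \<Rightarrow> 'x letter list" where
  "push_letter a [] = [a]"
| "push_letter a (b # w) = (if b = inv_letter a then w else a # b # w)"

definition free_group :: "'x set \<Rightarrow> 'x letter list monoid" where
  "free_group A =
     \<lparr>carrier = {w. set w \<subseteq> A \<times> UNIV \<and> reduced w},
      monoid.mult = foldr push_letter,
      one = []\<rparr>"

definition letter_val :: "('a, 'b) monoid_scheme \<Rightarrow> ('x \<Rightarrow> 'a) \<Rightarrow> 'x letter \<Rightarrow> 'a" where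
  "letter_val G g a = (if snd a then g (fst a) else inv\<^bsub>G\<^esub> g (fst a))"

definition word_val :: "('a, 'b) monoid_scheme \<Rightarrow> ('x \<Rightarrow> 'a) \<Rightarrow> 'x letter list \<Rightarrow> 'a" where
  "word_val G g w = foldr (\<lambda>a y. letter_val G g a \<otimes>\<^bsub>G\<^esub> y) w \<one>\<^bsub>G\<^esub>"

definition word_values :: "('a, 'b) monoid_scheme \<Rightarrow> 'x set \<Rightarrow> 'x letter list \<Rightarrow> 'a set" where
  "word_values G A w =
     (\<Union>g \<in> A \<rightarrow> carrier G. {word_val G g w, inv\<^bsub>G\<^esub> word_val G g w})"

definition prod_set :: "('a, 'b) monoid_scheme \<Rightarrow> 'a set \<Rightarrow> nat \<Rightarrow> 'a set" where
  "prod_set G S k = {foldr (\<otimes>\<^bsub>G\<^esub>) ss \<one>\<^bsub>G\<^esub> | ss. length ss = k \<and> set ss \<subseteq> S}"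


text \<open>\<open>free_group A\<close> is a group, and \<open>word_val G g\<close> is the homomorphism to \<open>G\<close> extending \<open>g\<close>.\<close>

lemma inv_letter_inv_letter [simp]: "inv_letter (inv_letter a) = a"
  by (simp add: inv_letter_def)

lemma inv_letter_neq [simp]: "inv_letter a \<noteq> a" "a \<noteq> inv_letter a"
  by (auto simp: inv_letter_def prod_eq_iff)

lemma inv_letter_eq_iff [simp]: "inv_letter a = inv_letter b \<longleftrightarrow> a = b"
  by (metis inv_letter_inv_letter)

lemma reduced_Nil [simp]: "reduced []"
  by (simp add: reduced_def)

lemma reduced_Cons: "reduced (a # w) \<longleftrightarrow> reduced w \<and> (w = [] \<or> hd w \<noteq> inv_letter a)"
  by (auto simp: reduced_def successively_Cons)

lemma reduced_push_letter: "reduced w \<Longrightarrow> reduced (push_letter a w)"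
  by (cases w) (auto simp: reduced_Cons)

lemma reduced_foldr_push: "reduced w \<Longrightarrow> reduced (foldr push_letter u w)"
  by (induction u) (auto intro: reduced_push_letter)

lemma push_letter_cancel: "reduced w \<Longrightarrow> push_letter a (push_letter (inv_letter a) w) = w"
proof (cases w)
  case (Cons b v)
  assume "reduced w"
  with Cons have "reduced (b # v)" by simp
  then have "push_letter b v = b # v" by (cases v) (auto simp: reduced_Cons)
  with Cons show ?thesis by (cases "b = a") simp_all
qed simp

lemma push_letter_cancel': "reduced w \<Longrightarrow> push_letter (inv_letter a) (push_letter a w) = w"
  using push_letter_cancel[of w "inv_letter a"] by simp

lemma foldr_push_push:
  "reduced w \<Longrightarrow>
     foldr push_letter (push_letter a v) w = push_letter a (foldr push_letter v w)"
  by (cases v) (auto simp: push_letter_cancel reduced_foldr_push)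

lemma foldr_push_assoc:
  assumes "reduced w"
  shows "foldr push_letter (foldr push_letter u v) w = foldr push_letter u (foldr push_letter v w)"
  by (induction u) (auto simp: foldr_push_push assms)

lemma push_letter_reduced: "reduced (a # w) \<Longrightarrow> push_letter a w = a # w"
  by (cases w) (auto simp: reduced_Cons)

lemma foldr_push_Nil: "reduced w \<Longrightarrow> foldr push_letter w [] = w"
proof (induction w)
  case (Cons a w)
  then have "reduced w" by (simp add: reduced_Cons)
  with Cons show ?case by (simp add: push_letter_reduced)
qed simp

lemma foldr_push_inverse:
  "reduced w \<Longrightarrow> foldr push_letter (rev (map inv_letter u)) (foldr push_letter u w) = w"
  by (induction u arbitrary: w) (auto simp: push_letter_cancel' reduced_foldr_push)

lemma set_push_letter: "set (push_letter a w) \<subseteq> insert a (set w)"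
  by (cases w) auto

lemma set_foldr_push: "set (foldr push_letter u w) \<subseteq> set u \<union> set w"
proof (induction u)
  case (Cons a u)
  then show ?case using set_push_letter[of a "foldr push_letter u w"] by auto
qed simp

lemma reduced_inverse: "reduced w \<Longrightarrow> reduced (rev (map inv_letter w))"
  unfolding reduced_def successively_rev successively_map
  by (erule successively_mono) (metis inv_letter_inv_letter)

lemma set_inverse: "set w \<subseteq> A \<times> UNIV \<Longrightarrow> set (rev (map inv_letter w)) \<subseteq> A \<times> UNIV"
  by (auto simp: inv_letter_def)

theorem group_free_group: "group (free_group A)"
proof (rule groupI)
  fix u v assume "u \<in> carrier (free_group A)" "v \<in> carrier (free_group A)"
  then show "u \<otimes>\<^bsub>free_group A\<^esub> v \<in> carrier (free_group A)"
    using set_foldr_push[of u v] by (auto simp: free_group_def reduced_foldr_push)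
next
  fix w assume w: "w \<in> carrier (free_group A)"
  show "\<exists>v \<in> carrier (free_group A). v \<otimes>\<^bsub>free_group A\<^esub> w = \<one>\<^bsub>free_group A\<^esub>"
  proof
    show "rev (map inv_letter w) \<in> carrier (free_group A)"
      using w reduced_inverse[of w] set_inverse[of w A]
      unfolding free_group_def partial_object.simps mem_Collect_eq by blast
    show "rev (map inv_letter w) \<otimes>\<^bsub>free_group A\<^esub> w = \<one>\<^bsub>free_group A\<^esub>"
      using w foldr_push_inverse[of "[]" w] by (simp add: free_group_def foldr_push_Nil)
  qed
qed (auto simp: free_group_def foldr_push_assoc)

context group
begin

lemma letter_val_closed:
  "g \<in> A \<rightarrow> carrier G \<Longrightarrow> a \<in> A \<times> UNIV \<Longrightarrow> letter_val G g a \<in> carrier G"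
  by (auto simp: letter_val_def)

lemma word_val_closed:
  assumes "g \<in> A \<rightarrow> carrier G" "set w \<subseteq> A \<times> UNIV"
  shows "word_val G g w \<in> carrier G"
  using assms(2) letter_val_closed[OF assms(1)] by (induction w) (auto simp: word_val_def)

lemma word_val_push_letter:
  assumes g: "g \<in> A \<rightarrow> carrier G" and a: "a \<in> A \<times> UNIV" and w: "set w \<subseteq> A \<times> UNIV"
  shows "word_val G g (push_letter a w) = letter_val G g a \<otimes> word_val G g w"
proof (cases "\<exists>v. w = inv_letter a # v")
  case True
  then obtain v where v: "w = inv_letter a # v" by blast
  have a_inv: "letter_val G g (inv_letter a) = inv (letter_val G g a)"
    using Pi_mem[OF g] a by (auto simp: letter_val_def inv_letter_def)
  have "word_val G g v \<in> carrier G"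
    using word_val_closed[OF g] w v by simp
  then show ?thesis
    using v letter_val_closed[OF g a] a_inv
    by (simp add: word_val_def m_assoc[symmetric])
next
  case False
  then have "push_letter a w = a # w" by (cases w) auto
  then show ?thesis by (simp add: word_val_def)
qed

theorem word_val_hom:
  assumes g: "g \<in> A \<rightarrow> carrier G"
  shows "word_val G g \<in> hom (free_group A) G"
proof (rule homI)
  fix u v assume "u \<in> carrier (free_group A)" "v \<in> carrier (free_group A)"
  then have u: "set u \<subseteq> A \<times> UNIV" and v: "set v \<subseteq> A \<times> UNIV"
    by (auto simp: free_group_def)
  have "word_val G g (foldr push_letter u v) = word_val G g u \<otimes> word_val G g v"
    using u
  proof (induction u)
    case Nil
    show ?case using word_val_closed[OF g v] by (simp add: word_val_def)
  next
    case (Cons a u)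
    then have a: "a \<in> A \<times> UNIV" and u: "set u \<subseteq> A \<times> UNIV" by auto
    have "set (foldr push_letter u v) \<subseteq> A \<times> UNIV"
      using set_foldr_push[of u v] u v by blast
    then have "word_val G g (foldr push_letter (a # u) v) =
        letter_val G g a \<otimes> (word_val G g u \<otimes> word_val G g v)"
      using word_val_push_letter[OF g a] Cons.IH[OF u] by simp
    also have "\<dots> = word_val G g (a # u) \<otimes> word_val G g v"
      using letter_val_closed[OF g a] word_val_closed[OF g u] word_val_closed[OF g v]
      by (simp add: word_val_def m_assoc)
    finally show ?case .
  qed
  then show "word_val G g (u \<otimes>\<^bsub>free_group A\<^esub> v) = word_val G g u \<otimes> word_val G g v"
    by (simp add: free_group_def)
qed (use word_val_closed[OF g] in \<open>auto simp: free_group_def\<close>)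

lemma word_val_generator:
  "g \<in> A \<rightarrow> carrier G \<Longrightarrow> x \<in> A \<Longrightarrow> word_val G g [(x, True)] = g x"
  using Pi_mem[of g A "\<lambda>_. carrier G" x] by (simp add: word_val_def letter_val_def)

end

end

theory Submission
  imports Defs
begin

text \<open>
  The group will be an alternating group of large degree, and the word will have as its values
  only the identity and the images of a 3-cycle and its inverse under automorphisms. These
  move boundedly many points, so a product of \<open>k\<close> of them moves at most \<open>12 * k\<close> points, which is
  too few to reach every even permutation of \<open>12 * k + 17\<close> points.

  Such a word exists for every element \<open>c\<close> of every finite non-abelian simple group \<open>G\<close>
  (\<open>word_with_values_in_one_automorphism_orbit\<close>). Let \<open>F\<close> be free on one generator for each element
  of \<open>G\<close>. A word map is evaluation of one fixed word under all homomorphisms \<open>F \<rightarrow> G\<close>, of which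
  there are finitely many; let \<open>h\<close> be a surjective one. A homomorphism whose kernel is not
  contained in that of \<open>h\<close> can be killed without restricting what \<open>h\<close> sees, because the image of
  its kernel under \<open>h\<close> is a non-trivial normal subgroup of \<open>G\<close>, hence all of \<open>G\<close>. Finitely many of
  them can be killed at once: if \<open>M\<close> and \<open>N\<close> are normal in \<open>F\<close> and both map onto \<open>G\<close>, then \<open>M \<inter> N\<close>
  contains all commutators of \<open>M\<close> with \<open>N\<close>, so that its image is trivial only if \<open>G\<close> is abelian. So some
  word is sent to \<open>c\<close> by \<open>h\<close> and to the identity by all these homomorphisms. A homomorphism
  whose kernel is contained in that of \<open>h\<close> is \<open>h\<close> followed by an automorphism, by counting, and
  takes the word to an image of \<open>c\<close> under an automorphism.

  It remains to see that automorphisms take a 3-cycle to elements that move few points. The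
  automorphism group need not be known for this: an automorphism preserves the size of
  conjugacy classes, a 3-cycle has at most \<open>n ^ 3\<close> conjugates, and a permutation that
  moves at least 12 of \<open>n\<close> points has about \<open>n ^ 4\<close> conjugates or more.

  Simplicity of the alternating group and the last estimate both rest on the fact that an
  injection whose domain omits at least two points extends to an even permutation.
\<close>


section \<open>Words with prescribed values in a finite simple group\<close>

lemma (in simple_group) normal_image_eq_carrier:
  assumes h: "group_hom F G h" "h ` carrier F = carrier G"
    and N: "N \<lhd> F" "\<not> N \<subseteq> kernel F G h"
  shows "h ` N = carrier G"
proof -
  interpret N: normal N F by (rule N(1))
  have "h ` N \<lhd> G"
    using N.surj_hom_normal_subgroup[OF h] .
  moreover have "h ` N \<noteq> {\<one>}"
    using N N.subset by (auto simp: kernel_def)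
  ultimately show ?thesis
    using no_real_normal_subgroup by blast
qed

text \<open>
  If the image of \<open>M \<inter> N\<close> were not everything, it would be trivial. But \<open>M \<inter> N\<close> contains every
  commutator of an element of \<open>M\<close> with an element of \<open>N\<close>, and their images are all the commutators of
  the simple group.
\<close>

lemma (in simple_group) normal_Int_image_eq_carrier:
  assumes noncomm: "\<not> comm_group G"
    and h: "group_hom F G h" "h ` carrier F = carrier G"
    and M: "M \<lhd> F" "h ` M = carrier G" and N: "N \<lhd> F" "h ` N = carrier G"
  shows "h ` (M \<inter> N) = carrier G"
proof (rule ccontr)
  interpret F: group_hom F G h by (rule h(1))
  interpret M: normal M F by (rule M(1))
  interpret N: normal N F by (rule N(1))
  assume "h ` (M \<inter> N) \<noteq> carrier G"
  then have ker: "M \<inter> N \<subseteq> kernel F G h"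
    using normal_image_eq_carrier[OF h F.G.normal_subgroup_intersect[OF M(1) N(1)]] by blast
  have "x \<otimes> y = y \<otimes> x" if "x \<in> carrier G" "y \<in> carrier G" for x y
  proof -
    have "x \<in> h ` M" "y \<in> h ` N"
      using that M(2) N(2) by auto
    then obtain m n where m: "m \<in> M" "x = h m" and n: "n \<in> N" "y = h n"
      by blast
    have mF: "m \<in> carrier F" and nF: "n \<in> carrier F"
      using m n M.subset N.subset by auto
    define z where "z = m \<otimes>\<^bsub>F\<^esub> n \<otimes>\<^bsub>F\<^esub> inv\<^bsub>F\<^esub> m \<otimes>\<^bsub>F\<^esub> inv\<^bsub>F\<^esub> n"
    have "z \<in> N"
      unfolding z_def using N.inv_op_closed2[OF mF n(1)] n(1) by (simp add: N.m_closed N.m_inv_closed)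
    moreover have "z = m \<otimes>\<^bsub>F\<^esub> (n \<otimes>\<^bsub>F\<^esub> inv\<^bsub>F\<^esub> m \<otimes>\<^bsub>F\<^esub> inv\<^bsub>F\<^esub> n)"
      unfolding z_def using mF nF by (simp add: F.G.m_assoc)
    then have "z \<in> M"
      using M.inv_op_closed2[OF nF M.m_inv_closed[OF m(1)]] m(1) by (simp add: M.m_closed)
    ultimately have "h z = \<one>"
      using ker by (auto simp: kernel_def)
    then have "x \<otimes> y \<otimes> inv x \<otimes> inv y = \<one>"
      unfolding z_def m n using mF nF by simp
    then show ?thesis
      using that by (simp add: inv_solve_right')
  qed
  then have "comm_group G"
    by (intro group_comm_groupI) auto
  with noncomm show False ..
qed

text \<open>
  This is the tool for killing a word under finitely many homomorphisms without constraining its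
  value under one more: the normal subgroups in \<open>NN\<close> will be kernels.
\<close>

lemma (in simple_group) exists_in_finite_intersection:
  assumes noncomm: "\<not> comm_group G"
    and h: "group_hom F G h" "h ` carrier F = carrier G"
    and NN: "finite NN" "\<And>N. N \<in> NN \<Longrightarrow> N \<lhd> F \<and> \<not> N \<subseteq> kernel F G h"
    and c: "c \<in> carrier G"
  shows "\<exists>w \<in> carrier F. (\<forall>N \<in> NN. w \<in> N) \<and> h w = c"
proof -
  interpret F: group_hom F G h by (rule h(1))
  have "\<exists>M. M \<lhd> F \<and> (\<forall>N \<in> NN. M \<subseteq> N) \<and> h ` M = carrier G"
    using NN
  proof (induction NN rule: finite_induct)
    case empty
    show ?case using F.G.normal_self h(2) by auto
  next
    case (insert N NN)
    then obtain M where M: "M \<lhd> F" "\<forall>N \<in> NN. M \<subseteq> N" "h ` M = carrier G"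
      by auto
    have N: "N \<lhd> F" "h ` N = carrier G"
      using insert.prems[of N] normal_image_eq_carrier[OF h] by auto
    have "M \<inter> N \<lhd> F"
      using F.G.normal_subgroup_intersect M N by blast
    moreover have "h ` (M \<inter> N) = carrier G"
      using normal_Int_image_eq_carrier[OF noncomm h] M N by blast
    ultimately show ?case
      using M by blast
  qed
  then obtain M where M: "M \<lhd> F" "\<forall>N \<in> NN. M \<subseteq> N" "h ` M = carrier G"
    by blast
  have "M \<subseteq> carrier F"
    using M(1) normal_imp_subgroup subgroup.subset by blast
  moreover have "c \<in> h ` M"
    using c M(3) by simp
  then obtain w where "w \<in> M" "h w = c"
    by blast
  ultimately show ?thesis
    using M(2) by blast
qed

text \<open>
  The inclusion of kernels makes \<open>f x \<mapsto> h x\<close> well defined, from the image of \<open>f\<close> onto the whole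
  group. Since the group is finite, \<open>f\<close> is therefore surjective as well and the map is bijective.
\<close>

lemma hom_factor_through_automorphism:
  assumes f: "group_hom F G f" and h: "group_hom F G h" "h ` carrier F = carrier G"
    and fin: "finite (carrier G)" and ker: "kernel F G f \<subseteq> kernel F G h"
  shows "\<exists>\<beta> \<in> iso G G. \<forall>x \<in> carrier F. \<beta> (f x) = h x"
proof -
  interpret f: group_hom F G f by (rule f)
  interpret h: group_hom F G h by (rule h(1))
  have eq: "h x = h y" if xy: "x \<in> carrier F" "y \<in> carrier F" "f x = f y" for x y
  proof -
    have "x \<otimes>\<^bsub>F\<^esub> inv\<^bsub>F\<^esub> y \<in> kernel F G f"
      using xy by (simp add: kernel_def)
    then have "h (x \<otimes>\<^bsub>F\<^esub> inv\<^bsub>F\<^esub> y) = \<one>\<^bsub>G\<^esub>"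
      using ker unfolding kernel_def by blast
    then show ?thesis
      using xy by (simp add: f.H.inv_solve_right')
  qed
  define \<beta> where "\<beta> = (\<lambda>z. h (inv_into (carrier F) f z))"
  have \<beta>: "\<beta> (f x) = h x" if "x \<in> carrier F" for x
    unfolding \<beta>_def using that by (intro eq) (auto simp: inv_into_into f_inv_into_f)
  have img: "\<beta> ` f ` carrier F = carrier G"
    using \<beta> h(2) by (auto simp: image_image)
  have sub: "f ` carrier F \<subseteq> carrier G"
    by auto
  have "card (carrier G) \<le> card (f ` carrier F)"
    using card_image_le[OF finite_subset[OF sub fin], of \<beta>] img by simp
  then have f_surj: "f ` carrier F = carrier G"
    using card_seteq[OF fin sub] by simp
  then have "inj_on \<beta> (carrier G)"
    using img fin by (intro eq_card_imp_inj_on) auto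
  moreover have "\<beta> \<in> hom G G"
  proof (rule homI)
    fix x y assume "x \<in> carrier G" "y \<in> carrier G"
    then have "x \<in> f ` carrier F" "y \<in> f ` carrier F"
      using f_surj by simp_all
    then obtain u v where uv: "u \<in> carrier F" "v \<in> carrier F" "x = f u" "y = f v"
      by blast
    then show "\<beta> (x \<otimes>\<^bsub>G\<^esub> y) = \<beta> x \<otimes>\<^bsub>G\<^esub> \<beta> y"
      using \<beta>[of "u \<otimes>\<^bsub>F\<^esub> v"] by (simp add: \<beta>)
  qed (use img f_surj in auto)
  ultimately have "\<beta> \<in> iso G G"
    using img f_surj by (simp add: iso_iff)
  with \<beta> show ?thesis by blast
qed

lemma word_val_cong:
  assumes "\<And>x. x \<in> A \<Longrightarrow> g x = g' x" "set w \<subseteq> A \<times> UNIV"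
  shows "word_val G g w = word_val G g' w"
  using assms(2) by (induction w) (auto simp: word_val_def letter_val_def assms(1))

text \<open>
  The generators are matched with the elements of the group, so that evaluation at \<open>g\<^sub>0\<close> is
  surjective. The word is chosen in the kernel of each evaluation whose kernel is not contained in
  that of \<open>g\<^sub>0\<close>; the other evaluations differ from the one at \<open>g\<^sub>0\<close> by an automorphism only.
\<close>

theorem (in simple_group) word_with_values_in_one_automorphism_orbit:
  assumes noncomm: "\<not> comm_group G" and fin: "finite (carrier G)" and c: "c \<in> carrier G"
  shows "\<exists>(d :: nat) w g\<^sub>0. w \<in> carrier (free_group {1..d}) \<and>
           g\<^sub>0 \<in> {1..d} \<rightarrow> carrier G \<and> word_val G g\<^sub>0 w = c \<and>
           (\<forall>g \<in> {1..d} \<rightarrow> carrier G.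
              word_val G g w = \<one> \<or> (\<exists>\<beta> \<in> iso G G. \<beta> (word_val G g w) = c))"
proof -
  define d where "d = card (carrier G)"
  let ?A = "{1..d}"
  let ?F = "free_group ?A"
  have hom: "group_hom ?F G (word_val G g)" if "g \<in> ?A \<rightarrow> carrier G" for g
    using word_val_hom[OF that] group_free_group
    by (simp add: group_hom_def group_hom_axioms_def is_group)
  obtain g\<^sub>0 where g\<^sub>0: "bij_betw g\<^sub>0 ?A (carrier G)"
    using finite_same_card_bij[of ?A "carrier G"] fin by (auto simp: d_def)
  then have g\<^sub>0_mem: "g\<^sub>0 \<in> ?A \<rightarrow> carrier G"
    by (auto simp: bij_betw_def)
  let ?h = "word_val G g\<^sub>0"
  have surj: "?h ` carrier ?F = carrier G"
  proof
    show "?h ` carrier ?F \<subseteq> carrier G"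
      using group_hom.hom_closed[OF hom[OF g\<^sub>0_mem]] by auto
    show "carrier G \<subseteq> ?h ` carrier ?F"
    proof
      fix y assume "y \<in> carrier G"
      then have "y \<in> g\<^sub>0 ` ?A"
        using bij_betw_imp_surj_on[OF g\<^sub>0] by simp
      then obtain x where x: "x \<in> ?A" "y = g\<^sub>0 x"
        by blast
      then have "y = ?h [(x, True)]"
        using word_val_generator[OF g\<^sub>0_mem] by simp
      moreover have "[(x, True)] \<in> carrier ?F"
        using x by (simp add: free_group_def reduced_Cons)
      ultimately show "y \<in> ?h ` carrier ?F" by blast
    qed
  qed
  \<comment> \<open>There are infinitely many \<open>g\<close> in the function space, but only their restrictions matter.\<close>
  define NN where
    "NN = {N \<in> (\<lambda>g. kernel ?F G (word_val G g)) ` (?A \<rightarrow>\<^sub>E carrier G). \<not> N \<subseteq> kernel ?F G ?h}"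
  have finNN: "finite NN"
    unfolding NN_def using fin by (intro finite_Collect_conjI disjI1) (auto intro!: finite_PiE)
  have NN: "N \<lhd> ?F \<and> \<not> N \<subseteq> kernel ?F G ?h" if "N \<in> NN" for N
    using that group_hom.normal_kernel[OF hom] unfolding NN_def by (auto simp: PiE_iff Pi_iff)
  obtain w where w: "w \<in> carrier ?F" "\<forall>N \<in> NN. w \<in> N" "?h w = c"
    using exists_in_finite_intersection[OF noncomm hom[OF g\<^sub>0_mem] surj finNN NN c] by blast
  have "word_val G g w = \<one> \<or> (\<exists>\<beta> \<in> iso G G. \<beta> (word_val G g w) = c)"
    if g: "g \<in> ?A \<rightarrow> carrier G" for g
  proof (cases "kernel ?F G (word_val G g) \<subseteq> kernel ?F G ?h")
    case True
    then show ?thesis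
      using hom_factor_through_automorphism[OF hom[OF g] hom[OF g\<^sub>0_mem] surj fin] w by blast
  next
    case False
    have "word_val G g v = word_val G (restrict g ?A) v" if "v \<in> carrier ?F" for v
      using that by (intro word_val_cong[of ?A]) (auto simp: free_group_def)
    then have "kernel ?F G (word_val G g) = kernel ?F G (word_val G (restrict g ?A))"
      by (auto simp: kernel_def)
    moreover have "restrict g ?A \<in> ?A \<rightarrow>\<^sub>E carrier G"
      using g by auto
    ultimately have "kernel ?F G (word_val G g) \<in> NN"
      unfolding NN_def using False by blast
    then have "w \<in> kernel ?F G (word_val G g)"
      using w by blast
    then show ?thesis by (simp add: kernel_def)
  qed
  then show ?thesis
    using w g\<^sub>0_mem by blast
qed

section \<open>Even permutations\<close>

lemma exists_two_distinct_elements: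
  assumes "2 \<le> card A"
  shows "\<exists>u \<in> A. \<exists>v \<in> A. u \<noteq> v"
proof (rule ccontr)
  assume "\<not> ?thesis"
  then have "card A \<le> Suc 0"
    using assms by (subst card_le_Suc0_iff_eq) (auto intro: card_ge_0_finite)
  with assms show False by simp
qed

text \<open>
  Any extension to a permutation will do if it is even; if it is odd, composing it with a
  transposition of two points outside \<open>B\<close> corrects the parity and leaves the values on \<open>B\<close> alone.
\<close>

lemma exists_even_permutation_extending:
  assumes S: "finite S" "B \<subseteq> S" and f: "inj_on f B" "f ` B \<subseteq> S"
    and room: "card B + 2 \<le> card S"
  shows "\<exists>p. p permutes S \<and> evenperm p \<and> (\<forall>x \<in> B. p x = f x)"
proof -
  have "card (S - B) = card (S - f ` B)"
    using S f by (simp add: card_Diff_subset finite_subset card_image)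
  then obtain e where e: "bij_betw e (S - B) (S - f ` B)"
    using finite_same_card_bij S by (metis finite_Diff)
  define p where "p x = (if x \<in> B then f x else if x \<in> S then e x else x)" for x
  have "bij_betw p B (f ` B)"
    using f by (intro bij_betw_imageI) (auto simp: p_def inj_on_def)
  moreover have "bij_betw p (S - B) (S - f ` B)"
    using e by (rule bij_betw_cong[THEN iffD1, rotated]) (simp add: p_def)
  ultimately have "bij_betw p (B \<union> (S - B)) (f ` B \<union> (S - f ` B))"
    by (rule bij_betw_combine) auto
  moreover have "B \<union> (S - B) = S" "f ` B \<union> (S - f ` B) = S"
    using S f by auto
  ultimately have p: "p permutes S"
    using S by (intro bij_imp_permutes) (auto simp: p_def)
  show ?thesis
  proof (cases "evenperm p")
    case True
    with p show ?thesis by (auto simp: p_def)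
  next
    case False
    have "2 \<le> card (S - B)"
      using S room by (simp add: card_Diff_subset finite_subset)
    then obtain u v where uv: "u \<in> S - B" "v \<in> S - B" "u \<noteq> v"
      using exists_two_distinct_elements by blast
    let ?q = "p \<circ> transpose u v"
    have "?q permutes S"
      using p uv by (intro permutes_compose permutes_swap_id) auto
    moreover have "evenperm ?q"
      using False uv p S
      by (subst evenperm_comp)
        (auto simp: evenperm_swap permutation_swap_id intro: permutes_imp_permutation)
    moreover have "?q x = f x" if "x \<in> B" for x
      using that uv by (auto simp: p_def transpose_def)
    ultimately show ?thesis by blast
  qed
qed

text \<open>
  Moved points are the measure of size in all that follows: their number is subadditive under
  composition and invariant under conjugation and inversion.
\<close>

definition moved :: "('a \<Rightarrow> 'a) \<Rightarrow> 'a set" where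
  "moved p = {x. p x \<noteq> x}"

lemma moved_subset: "p permutes S \<Longrightarrow> moved p \<subseteq> S"
  by (auto simp: moved_def permutes_def)

lemma moved_comp: "moved (p \<circ> q) \<subseteq> moved p \<union> moved q"
  by (auto simp: moved_def)

lemma moved_inv:
  assumes "bij p"
  shows "moved (Hilbert_Choice.inv p) = moved p"
proof -
  have "Hilbert_Choice.inv p x = x \<longleftrightarrow> p x = x" for x
    using bij_inv_eq_iff[OF assms, of x x] by metis
  then show ?thesis by (simp add: moved_def)
qed

lemma moved_conj:
  assumes "bij h"
  shows "moved (h \<circ> p \<circ> Hilbert_Choice.inv h) = h ` moved p"
proof (rule Set.set_eqI)
  fix x
  have inj: "inj h" using assms by (rule bij_is_inj)
  obtain y where "x = h y"
    using surjD[OF bij_is_surj[OF assms]] by blast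
  then show "x \<in> moved (h \<circ> p \<circ> Hilbert_Choice.inv h) \<longleftrightarrow> x \<in> h ` moved p"
    using inj by (simp add: moved_def inj_eq inj_image_mem_iff)
qed

section \<open>The alternating group is simple\<close>

text \<open>
  Away from the single common point each permutation fixes what the other one moves, so they
  almost commute. The commutator equation is checked in the form \<open>x \<circ> y = c \<circ> (y \<circ> x)\<close>, where
  \<open>c\<close> is the 3-cycle.
\<close>

lemma commutator_eq_three_cycle:
  assumes x: "bij x" and y: "bij y" and meet: "moved x \<inter> moved y = {a}"
  shows "x \<circ> y \<circ> Hilbert_Choice.inv x \<circ> Hilbert_Choice.inv y = cycle_of_list [a, x a, y a]"
    and "distinct [a, x a, y a]"
proof -
  let ?x' = "Hilbert_Choice.inv x" and ?y' = "Hilbert_Choice.inv y"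
  have inj: "inj x" "inj y"
    using x y by (auto simp: bij_is_inj)
  have xx: "x u = x v \<longleftrightarrow> u = v" and yy: "y u = y v \<longleftrightarrow> u = v" for u v
    using inj by (simp_all add: inj_eq)
  have a: "x a \<noteq> a" "y a \<noteq> a" and only: "\<And>v. x v \<noteq> v \<Longrightarrow> y v \<noteq> v \<Longrightarrow> v = a"
    using meet by (auto simp: moved_def)
  have xa: "y (x a) = x a"
    using only[of "x a"] a xx by blast
  have ya: "x (y a) = y a"
    using only[of "y a"] a yy by blast
  have ne: "x a \<noteq> y a"
    using yy[of "x a" a] xa a by auto
  show "distinct [a, x a, y a]"
    using a ne by auto
  let ?c = "cycle_of_list [a, x a, y a]"
  have "x (y v) = ?c (y (x v))" for v
  proof -
    consider "v = a" | "x v = a" "v \<noteq> a" | "y v = a" "v \<noteq> a"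
      | "v \<noteq> a" "x v \<noteq> a" "y v \<noteq> a"
      by blast
    then show ?thesis
    proof cases
      case 1
      then show ?thesis using a ne xa ya by (simp add: transpose_def)
    next
      case 2
      then have "y v = v" using only[of v] by metis
      then show ?thesis using 2 a ne by (simp add: transpose_def)
    next
      case 3
      then have "x v = v" using only[of v] by metis
      then show ?thesis using 3 a ne by (simp add: transpose_def)
    next
      case 4
      have nx: "x v \<noteq> x a" "y v \<noteq> y a"
        using 4 by (simp_all add: xx yy)
      show ?thesis
      proof (cases "x v = v")
        case True
        have "y v \<noteq> x a"
          using True a yy[of v "x a"] xx[of v a] xa by metis
        moreover have "x (y v) = y v"
          using only[of "y v"] 4(3) yy[of "y v" v] True by auto
        ultimately show ?thesis using True 4 nx by (simp add: transpose_def)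
      next
        case False
        have yv: "y v = v"
          using only[of v] 4(1) False by blast
        have "y (x v) = x v"
          using only[of "x v"] 4(2) xx[of "x v" v] False by blast
        moreover have "x v \<noteq> y a"
          using yv a xx[of v "y a"] yy[of v a] ya by metis
        ultimately show ?thesis using yv 4 nx by (simp add: transpose_def)
      qed
    qed
  qed
  then have *: "x \<circ> y = ?c \<circ> (y \<circ> x)"
    by auto
  have "y \<circ> x \<circ> ?x' \<circ> ?y' = id"
    using x y by (auto simp: fun_eq_iff surj_f_inv_f bij_is_surj)
  then show "x \<circ> y \<circ> ?x' \<circ> ?y' = ?c"
    unfolding * by (simp add: comp_assoc)
qed

lemma alt_group_conj:
  assumes "h \<in> carrier (alt_group n)"
  shows "h \<otimes>\<^bsub>alt_group n\<^esub> p \<otimes>\<^bsub>alt_group n\<^esub> inv\<^bsub>alt_group n\<^esub> h = h \<circ> p \<circ> Hilbert_Choice.inv h"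
  using assms by (simp add: alt_group_mult alt_group_inv_equality)

lemma alt_group_extend:
  assumes "B \<subseteq> {1..n}" "inj_on f B" "f ` B \<subseteq> {1..n}" "card B + 2 \<le> n"
  obtains h where "h \<in> carrier (alt_group n)" "\<And>x. x \<in> B \<Longrightarrow> h x = f x"
  using exists_even_permutation_extending[of "{1..n}" B f] assms
  by (auto simp: alt_group_carrier)

lemma finite_carrier_alt_group: "finite (carrier (alt_group n))"
  by (rule finite_subset[OF _ finite_permutations[of "{1..n}"]]) (auto simp: alt_group_carrier)

lemma alt_group_bij: "p \<in> carrier (alt_group n) \<Longrightarrow> bij p"
  by (auto simp: alt_group_carrier permutes_bij)

text \<open>
  Five points leave two points outside the first cycle, which is what an even conjugating
  permutation needs.
\<close>

lemma three_cycles_conjugate: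
  assumes n: "n \<ge> 5" and s: "s \<in> three_cycles n" and t: "t \<in> three_cycles n"
  shows "\<exists>h \<in> carrier (alt_group n). t = h \<circ> s \<circ> Hilbert_Choice.inv h"
proof -
  obtain cs where cs: "s = cycle_of_list cs" "distinct cs" "length cs = 3" "set cs \<subseteq> {1..n}"
    using s by auto
  obtain ds where ds: "t = cycle_of_list ds" "distinct ds" "length ds = 3" "set ds \<subseteq> {1..n}"
    using t by auto
  obtain f where f: "bij_betw f (set cs) (set ds)" "map f cs = ds"
  proof -
    let ?f = "\<lambda>x. the (map_of (zip cs ds) x)"
    have m: "map ?f cs = ds"
      using cs ds by (intro nth_equalityI) (auto simp: map_of_zip_nth)
    then have "set (map ?f cs) = set ds" "distinct (map ?f cs)"
      using ds(2) by simp_all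
    then have "?f ` set cs = set ds" "inj_on ?f (set cs)"
      by (simp_all only: set_map distinct_map)
    then have "bij_betw ?f (set cs) (set ds)"
      by (simp add: bij_betw_def)
    then show ?thesis
      using m by (rule that)
  qed
  obtain h where h: "h \<in> carrier (alt_group n)" "\<And>x. x \<in> set cs \<Longrightarrow> h x = f x"
    using alt_group_extend[of "set cs" n f] f cs ds n distinct_card[of cs]
    by (auto simp: bij_betw_def)
  have "map h cs = ds"
    using h f(2) by (metis map_eq_conv)
  then show ?thesis
    using conjugation_of_cycle[OF cs(2) alt_group_bij[OF h(1)]] h(1) cs(1) ds(1) by metis
qed

lemma normal_alt_group_containing_three_cycle:
  assumes n: "n \<ge> 5" and N: "N \<lhd> alt_group n" and s: "s \<in> N" "s \<in> three_cycles n"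
  shows "N = carrier (alt_group n)"
proof -
  interpret N: normal N "alt_group n" by (rule N)
  have "three_cycles n \<subseteq> N"
  proof
    fix t assume "t \<in> three_cycles n"
    then obtain h where h: "h \<in> carrier (alt_group n)" "t = h \<circ> s \<circ> Hilbert_Choice.inv h"
      using three_cycles_conjugate[OF n s(2)] by blast
    then show "t \<in> N"
      using N.inv_op_closed2[OF h(1) s(1)] alt_group_conj[OF h(1)] by simp
  qed
  then have "generate (alt_group n) (three_cycles n) \<subseteq> N"
    by (intro N.generate_subgroup_incl N.subgroup_axioms)
  then show ?thesis
    using N.subset alt_group_carrier_as_three_cycles by blast
qed

lemma exists_three_cycle_not_commuting:
  assumes n: "n \<ge> 5" and g: "g \<in> carrier (alt_group n)" "g \<noteq> id"
  shows "\<exists>t \<in> three_cycles n. g \<circ> t \<noteq> t \<circ> g"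
proof -
  obtain a where a: "g a \<noteq> a"
    using g(2) by (auto simp: fun_eq_iff)
  have gp: "g permutes {1..n}"
    using g by (simp add: alt_group_carrier)
  have "a \<in> {1..n}"
    using a permutes_not_in[OF gp, of a] by blast
  then have aS: "a \<in> {1..n}" "g a \<in> {1..n}"
    using permutes_in_image[OF gp, of a] by blast+
  have "card ({1..n} - {a, g a}) \<ge> 2"
    using aS a n by (simp add: card_Diff_subset)
  then obtain c d where cd: "c \<in> {1..n} - {a, g a}" "d \<in> {1..n} - {a, g a}" "c \<noteq> d"
    using exists_two_distinct_elements by blast
  let ?t = "cycle_of_list [a, c, d]"
  have t: "?t \<in> three_cycles n"
    using aS cd by (intro CollectI exI[of _ "[a, c, d]"]) auto
  have "?t (g a) = g a" "?t a = c"
    using cd a by (auto simp: transpose_def)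
  moreover have "g c \<noteq> g a"
    using cd permutes_inj[OF gp] by (auto simp: inj_eq)
  ultimately have "(g \<circ> ?t) a \<noteq> (?t \<circ> g) a"
    by simp
  then have "g \<circ> ?t \<noteq> ?t \<circ> g"
    by (rule contrapos_nn) (rule fun_cong)
  then show ?thesis
    using t by (rule bexI)
qed

lemma moved_three_cycle: "moved (cycle_of_list cs) \<subseteq> set cs"
proof
  fix x assume "x \<in> moved (cycle_of_list cs)"
  then show "x \<in> set cs"
    using id_outside_supp[of x cs] by (auto simp: moved_def)
qed

text \<open>
  The commutator is the product of a conjugate of \<open>t\<close> and the inverse of \<open>t\<close>, each of which moves three
  points.
\<close>

lemma card_moved_commutator_three_cycle:
  assumes g: "bij g" and t: "t \<in> three_cycles n"
  shows "card (moved (g \<circ> t \<circ> Hilbert_Choice.inv g \<circ> Hilbert_Choice.inv t)) \<le> 6"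
proof -
  obtain cs where cs: "t = cycle_of_list cs" "distinct cs" "length cs = 3"
    using t by auto
  have "bij t"
    using cs(1) permutation_bijective[OF permutation_of_cycle] by simp
  have "moved (g \<circ> t \<circ> Hilbert_Choice.inv g \<circ> Hilbert_Choice.inv t)
      \<subseteq> moved (g \<circ> t \<circ> Hilbert_Choice.inv g) \<union> moved (Hilbert_Choice.inv t)"
    by (rule moved_comp)
  also have "\<dots> = g ` moved t \<union> moved t"
    by (simp only: moved_conj[OF g] moved_inv[OF \<open>bij t\<close>])
  also have "\<dots> \<subseteq> g ` set cs \<union> set cs"
    using moved_three_cycle[of cs] cs(1) by blast
  finally have "card (moved (g \<circ> t \<circ> Hilbert_Choice.inv g \<circ> Hilbert_Choice.inv t))
      \<le> card (g ` set cs \<union> set cs)"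
    by (intro card_mono) auto
  also have "\<dots> \<le> 6"
    using card_Un_le[of "g ` set cs" "set cs"] card_image_le[of "set cs" g]
      distinct_card[OF cs(2)] cs(3) by simp
  finally show ?thesis .
qed

text \<open>
  The conjugating permutation fixes \<open>a\<close> and pushes the other points moved by \<open>x\<close> to points that
  \<open>x\<close> fixes.
\<close>

lemma exists_conjugate_meeting_in_one_point:
  assumes x: "x \<in> carrier (alt_group n)" and a: "a \<in> moved x"
    and room: "2 * card (moved x) + 2 \<le> n"
  shows "\<exists>h \<in> carrier (alt_group n). moved x \<inter> moved (h \<circ> x \<circ> Hilbert_Choice.inv h) = {a}"
proof -
  let ?X = "moved x"
  have X: "?X \<subseteq> {1..n}"
    using x by (intro moved_subset) (simp add: alt_group_carrier)
  then have fin: "finite ?X"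
    using finite_subset by blast
  have "card (?X - {a}) \<le> card ({1..n} - ?X)"
    using room X fin card_Diff1_le[of ?X a] by (simp add: card_Diff_subset)
  then obtain f where f: "f ` (?X - {a}) \<subseteq> {1..n} - ?X" "inj_on f (?X - {a})"
    using card_le_inj[of "?X - {a}" "{1..n} - ?X"] fin by auto
  let ?f = "f(a := a)"
  have "inj_on ?f ?X"
    using f a unfolding inj_on_def by (auto simp: image_subset_iff)
  moreover have "?f ` ?X \<subseteq> {1..n}"
    using f X a by (auto simp del: atLeastAtMost_iff)
  ultimately obtain h where h: "h \<in> carrier (alt_group n)" "\<And>v. v \<in> ?X \<Longrightarrow> h v = ?f v"
    using alt_group_extend[of ?X n ?f] X room by auto
  have "?X \<inter> h ` ?X = {a}"
  proof (intro equalityI subsetI)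
    fix b assume "b \<in> ?X \<inter> h ` ?X"
    then obtain v where v: "v \<in> ?X" "b = ?f v" "b \<in> ?X"
      using h(2) by auto
    then have "v = a"
      using f(1) by (cases "v = a") auto
    then show "b \<in> {a}" using v by simp
  next
    fix b assume "b \<in> {a}"
    then show "b \<in> ?X \<inter> h ` ?X"
      using a h(2)[OF a] by (auto intro: rev_image_eqI)
  qed
  then show ?thesis
    using h(1) moved_conj[OF alt_group_bij[OF h(1)], of x] by (metis (no_types))
qed

text \<open>
  The commutator of \<open>g\<close> with a 3-cycle that does not commute with it is an element \<open>x\<close> of the normal
  subgroup that moves between one and six points. As \<open>2 * 6 + 2 \<le> n\<close>, there is room for a
  conjugate \<open>y\<close> that shares exactly one moved point with \<open>x\<close>. The commutator of \<open>x\<close> and \<open>y\<close> is then a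
  3-cycle, and the 3-cycles generate the alternating group.
\<close>

lemma normal_alt_group_nontrivial:
  assumes n: "n \<ge> 14" and N: "N \<lhd> alt_group n" and g: "g \<in> N" "g \<noteq> id"
  shows "N = carrier (alt_group n)"
proof -
  interpret N: normal N "alt_group n" by (rule N)
  have comm: "u \<circ> v \<circ> Hilbert_Choice.inv u \<circ> Hilbert_Choice.inv v \<in> N"
    if u: "u \<in> N" and v: "v \<in> carrier (alt_group n)" for u v
  proof -
    have uG: "u \<in> carrier (alt_group n)"
      using u N.subset by blast
    have "Hilbert_Choice.inv u \<in> N"
      using N.m_inv_closed[OF u] alt_group_inv_equality[OF uG] by simp
    then have "v \<circ> Hilbert_Choice.inv u \<circ> Hilbert_Choice.inv v \<in> N"
      using N.inv_op_closed2[OF v] alt_group_conj[OF v] by simp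
    then show ?thesis
      using subgroup.m_closed[OF N.subgroup_axioms u] by (simp add: alt_group_mult comp_assoc)
  qed
  have n5: "n \<ge> 5"
    using n by simp
  have gG: "g \<in> carrier (alt_group n)"
    using g N.subset by blast
  obtain t where t: "t \<in> three_cycles n" and gt: "g \<circ> t \<noteq> t \<circ> g"
    using exists_three_cycle_not_commuting[OF n5 gG g(2)] by blast
  have tG: "t \<in> carrier (alt_group n)"
    using t three_cycles_incl by blast
  define x where "x = g \<circ> t \<circ> Hilbert_Choice.inv g \<circ> Hilbert_Choice.inv t"
  have xN: "x \<in> N"
    unfolding x_def using comm[OF g(1) tG] .
  then have xG: "x \<in> carrier (alt_group n)"
    using N.subset by blast
  obtain v where v: "g (t v) \<noteq> t (g v)"
    using gt by (auto simp: fun_eq_iff)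
  define a where "a = t (g v)"
  have "x a = g (t v)"
    using alt_group_bij[OF tG] alt_group_bij[OF gG] by (simp add: x_def a_def bij_is_inj)
  then have a: "a \<in> moved x"
    using v by (simp add: moved_def a_def)
  have "card (moved x) \<le> 6"
    unfolding x_def by (rule card_moved_commutator_three_cycle[OF alt_group_bij[OF gG] t])
  then obtain h where h: "h \<in> carrier (alt_group n)"
    and meet: "moved x \<inter> moved (h \<circ> x \<circ> Hilbert_Choice.inv h) = {a}"
    using exists_conjugate_meeting_in_one_point[OF xG a] n by auto
  define y where "y = h \<circ> x \<circ> Hilbert_Choice.inv h"
  have "y \<in> N"
    unfolding y_def using N.inv_op_closed2[OF h xN] alt_group_conj[OF h] by simp
  then have yG: "y \<in> carrier (alt_group n)"
    using N.subset by blast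
  define z where "z = x \<circ> y \<circ> Hilbert_Choice.inv x \<circ> Hilbert_Choice.inv y"
  have z: "z = cycle_of_list [a, x a, y a]" "distinct [a, x a, y a]"
    unfolding z_def
    using commutator_eq_three_cycle[OF alt_group_bij[OF xG] alt_group_bij[OF yG] meet[folded y_def]] .
  have "z \<in> N"
    unfolding z_def using comm[OF xN yG] .
  moreover have "z \<in> three_cycles n"
  proof -
    have xp: "x permutes {1..n}" and yp: "y permutes {1..n}"
      using xG yG by (simp_all add: alt_group_carrier)
    have "a \<in> {1..n}"
      using a moved_subset[OF xp] by blast
    then have "set [a, x a, y a] \<subseteq> {1..n}"
      using permutes_in_image[OF xp, of a] permutes_in_image[OF yp, of a] by simp
    then show ?thesis
      unfolding z(1) using z(2) by (intro CollectI exI[of _ "[a, x a, y a]"]) simp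
  qed
  ultimately show ?thesis
    using n by (intro normal_alt_group_containing_three_cycle[OF n5 N])
qed

theorem alt_group_simple:
  assumes n: "n \<ge> 14"
  shows "simple_group (alt_group n)"
proof (intro simple_group.intro simple_group_axioms.intro alt_group_is_group)
  have "2 * order (alt_group n) = fact n"
    using alt_group_card_carrier[of n] n by (simp add: order_def)
  moreover have "fact n \<ge> n"
    by (rule fact_ge_self)
  ultimately show "1 < order (alt_group n)"
    using n by linarith
next
  fix N assume N: "N \<lhd> alt_group n"
  have "\<one>\<^bsub>alt_group n\<^esub> \<in> N"
    using N normal_imp_subgroup subgroup.one_closed by blast
  then have "id \<in> N"
    by (simp add: alt_group_one)
  then show "N = carrier (alt_group n) \<or> N = {\<one>\<^bsub>alt_group n\<^esub>}"
    using normal_alt_group_nontrivial[OF n N] by (auto simp: alt_group_one)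
qed

lemma alt_group_not_comm:
  assumes n: "n \<ge> 5"
  shows "\<not> comm_group (alt_group n)"
proof
  assume "comm_group (alt_group n)"
  then interpret comm_group "alt_group n" .
  let ?t = "cycle_of_list [1, 2, 3 :: nat]"
  have t: "?t \<in> carrier (alt_group n)"
    using three_cycles_incl[of n] n by (auto intro!: subsetD[OF three_cycles_incl] exI[of _ "[1, 2, 3]"])
  have "?t 1 \<noteq> 1" by (simp add: transpose_def)
  then have "?t \<noteq> id" by (metis id_apply)
  then obtain s where s: "s \<in> three_cycles n" "?t \<circ> s \<noteq> s \<circ> ?t"
    using exists_three_cycle_not_commuting[OF n t] by blast
  then have "s \<in> carrier (alt_group n)"
    using three_cycles_incl by blast
  then show False
    using s(2) m_comm[OF t] by (simp add: alt_group_mult)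
qed

section \<open>Conjugacy classes and moved points\<close>

definition conjugacy_class :: "('a, 'b) monoid_scheme \<Rightarrow> 'a \<Rightarrow> 'a set" where
  "conjugacy_class G x = (\<lambda>h. h \<otimes>\<^bsub>G\<^esub> x \<otimes>\<^bsub>G\<^esub> inv\<^bsub>G\<^esub> h) ` carrier G"

lemma card_conjugacy_class_iso:
  assumes "group G" "group H" "\<alpha> \<in> iso G H" "x \<in> carrier G"
  shows "card (conjugacy_class H (\<alpha> x)) = card (conjugacy_class G x)"
proof -
  interpret group_hom G H \<alpha>
    using assms by (simp add: group_hom_def group_hom_axioms_def iso_iff)
  have surj: "\<alpha> ` carrier G = carrier H" and inj: "inj_on \<alpha> (carrier G)"
    using assms(3) by (simp_all add: Group.iso_iff)
  have "conjugacy_class H (\<alpha> x) = \<alpha> ` conjugacy_class G x"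
    unfolding conjugacy_class_def surj[symmetric] image_image using assms(4) by simp
  moreover have "conjugacy_class G x \<subseteq> carrier G"
    using assms(4) by (auto simp: conjugacy_class_def)
  ultimately show ?thesis
    using inj by (metis card_image inj_on_subset)
qed

lemma conjugacy_class_alt_group:
  "conjugacy_class (alt_group n) p = (\<lambda>h. h \<circ> p \<circ> Hilbert_Choice.inv h) ` carrier (alt_group n)"
  unfolding conjugacy_class_def by (rule image_cong) (simp_all add: alt_group_conj)

text \<open>
  A conjugate of a cycle is obtained by relabelling its entries, so it is determined by three points.
\<close>

lemma card_conjugacy_class_three_cycle:
  assumes "t \<in> three_cycles n"
  shows "card (conjugacy_class (alt_group n) t) \<le> n ^ 3"
proof -
  obtain cs where cs: "t = cycle_of_list cs" "distinct cs" "length cs = 3" "set cs \<subseteq> {1..n}"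
    using assms by auto
  let ?L = "{ds. set ds \<subseteq> {1..n} \<and> length ds = 3}"
  have "conjugacy_class (alt_group n) t \<subseteq> cycle_of_list ` ?L"
  proof
    fix s assume "s \<in> conjugacy_class (alt_group n) t"
    then obtain h where h: "h \<in> carrier (alt_group n)" "s = h \<circ> t \<circ> Hilbert_Choice.inv h"
      unfolding conjugacy_class_alt_group by blast
    have "s = cycle_of_list (map h cs)"
      using conjugation_of_cycle[OF cs(2) alt_group_bij[OF h(1)]] h(2) cs(1) by simp
    moreover have "map h cs \<in> ?L"
      using cs h(1) permutes_in_image[of h "{1..n}"] by (auto simp: alt_group_carrier)
    ultimately show "s \<in> cycle_of_list ` ?L" by blast
  qed
  then have "card (conjugacy_class (alt_group n) t) \<le> card ?L"
    by (intro surj_card_le finite_lists_length_eq) auto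
  also have "\<dots> = n ^ 3"
    using card_lists_length_eq[of "{1..n}" 3] by simp
  finally show ?thesis .
qed

text \<open>
  Points are picked one at a time. Each chosen point \<open>b\<close> rules out only \<open>b\<close>, its image and its
  preimage for later choices.
\<close>

lemma exists_subset_disjoint_from_image:
  assumes "inj p" "finite (moved p)" "3 * m \<le> card (moved p)"
  shows "\<exists>B \<subseteq> moved p. finite B \<and> card B = m \<and> B \<inter> p ` B = {}"
  using assms(3)
proof (induction m)
  case 0
  show ?case by (intro exI[of _ "{}"]) auto
next
  case (Suc m)
  then obtain B where B: "B \<subseteq> moved p" "finite B" "card B = m" "B \<inter> p ` B = {}"
    by auto
  let ?U = "B \<union> p ` B \<union> p -` B"
  have fin: "finite ?U"
    using B(2) assms(1) by (simp add: finite_vimageI)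
  have "card (p -` B) \<le> m"
    using card_vimage_inj_on_le[of p UNIV B] assms(1) B by simp
  then have "card ?U \<le> 3 * m"
    using card_Un_le[of "B \<union> p ` B" "p -` B"] card_Un_le[of B "p ` B"] card_image_le[OF B(2), of p] B(3)
    by linarith
  then have "card ?U < card (moved p)"
    using Suc.prems by simp
  then have "\<not> moved p \<subseteq> ?U"
    using card_mono[OF fin] leD by blast
  then obtain a where a: "a \<in> moved p" "a \<notin> ?U"
    by blast
  show ?case
  proof (intro exI[of _ "insert a B"] conjI)
    show "insert a B \<inter> p ` insert a B = {}"
      using a B(4) assms(1) by (auto simp: moved_def)
  qed (use a B in auto)
qed

text \<open>
  Choose a set \<open>B\<close> of \<open>m\<close> moved points that is disjoint from its image. For every injection \<open>f\<close> of
  \<open>B\<close> into the complement of \<open>B\<close> there is an even \<open>h\<close> that fixes \<open>B\<close> pointwise and takes \<open>p b\<close> to \<open>f b\<close>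
  for \<open>b\<close> in \<open>B\<close>, and then the conjugate of \<open>p\<close> by \<open>h\<close> agrees with \<open>f\<close> on \<open>B\<close>. So there are at least as
  many conjugates as injections; the product counts the latter.
\<close>

lemma card_conjugacy_class_ge:
  assumes p: "p \<in> carrier (alt_group n)" and m: "3 * m \<le> card (moved p)" "2 * m + 2 \<le> n"
  shows "card (conjugacy_class (alt_group n) p) \<ge> (\<Prod>i = 0..<m. n - m - i)"
proof -
  have perm: "p permutes {1..n}"
    using p by (simp add: alt_group_carrier)
  have mp: "moved p \<subseteq> {1..n}"
    using moved_subset[OF perm] .
  obtain B where B: "B \<subseteq> moved p" "finite B" "card B = m" "B \<inter> p ` B = {}"
    using exists_subset_disjoint_from_image[OF permutes_inj[OF perm] _ m(1)] mp finite_subset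
    by (metis finite_atLeastAtMost)
  have BS: "B \<subseteq> {1..n}" using B mp by blast
  have pBS: "p ` B \<subseteq> {1..n}"
    using BS permutes_in_image[OF perm] by auto
  let ?I = "{f \<in> B \<rightarrow>\<^sub>E {1..n} - B. inj_on f B}"
  let ?r = "\<lambda>q. restrict q B"
  have "?I \<subseteq> ?r ` conjugacy_class (alt_group n) p"
  proof
    fix f assume "f \<in> ?I"
    then have f: "f \<in> B \<rightarrow>\<^sub>E {1..n} - B" "inj_on f B" by auto
    let ?p' = "Hilbert_Choice.inv p"
    \<comment> \<open>\<open>k\<close> is the partial injection that the conjugating permutation has to extend.\<close>
    define k where "k x = (if x \<in> B then x else f (?p' x))" for x
    have k_B: "k x = x" if "x \<in> B" for x
      using that by (simp add: k_def)
    have k_pB: "k (p x) = f x" if "x \<in> B" for x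
    proof -
      have "p x \<notin> B"
        using that B(4) by blast
      then show ?thesis
        unfolding k_def permutes_inverses(2)[OF perm] by simp
    qed
    have k_img: "k ` B = B" "k ` p ` B = f ` B"
      using k_B k_pB by (simp_all add: image_image)
    have fB: "f ` B \<subseteq> {1..n} - B"
      using f(1) by (simp add: PiE_iff image_subset_iff)
    have "inj_on k (B \<union> p ` B)"
      unfolding inj_on_Un
    proof (intro conjI)
      show "inj_on k B"
        using k_B by (simp add: inj_on_def)
      have "inj_on (k \<circ> p) B"
        using f(2) k_pB by (simp add: inj_on_def)
      then show "inj_on k (p ` B)"
        by (rule inj_on_imageI)
      show "k ` (B - p ` B) \<inter> k ` (p ` B - B) = {}"
        using k_img fB by blast
    qed
    moreover have "k ` (B \<union> p ` B) \<subseteq> {1..n}"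
      using k_img fB BS by blast
    moreover have "card (B \<union> p ` B) + 2 \<le> n"
      using card_Un_le[of B "p ` B"] card_image_le[OF B(2), of p] B(3) m(2) by linarith
    moreover have "B \<union> p ` B \<subseteq> {1..n}"
      using BS pBS by blast
    ultimately obtain h where h: "h \<in> carrier (alt_group n)" "\<And>x. x \<in> B \<union> p ` B \<Longrightarrow> h x = k x"
      using alt_group_extend[of "B \<union> p ` B" n k] by blast
    let ?q = "h \<circ> p \<circ> Hilbert_Choice.inv h"
    have "?q x = f x" if x: "x \<in> B" for x
    proof -
      have "h x = x" using h(2)[of x] x k_B by simp
      then have "Hilbert_Choice.inv h x = x"
        using alt_group_bij[OF h(1)] by (metis bij_inv_eq_iff)
      then show ?thesis
        using h(2)[of "p x"] x k_pB[OF x] by simp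
    qed
    then have "f = ?r ?q"
      using PiE_restrict[OF f(1)] by (metis (no_types, lifting) restrict_ext)
    moreover have "?q \<in> conjugacy_class (alt_group n) p"
      unfolding conjugacy_class_alt_group using h(1) by (rule imageI)
    ultimately show "f \<in> ?r ` conjugacy_class (alt_group n) p" by blast
  qed
  moreover have "finite (conjugacy_class (alt_group n) p)"
    unfolding conjugacy_class_def by (intro finite_imageI finite_carrier_alt_group)
  ultimately have "card ?I \<le> card (conjugacy_class (alt_group n) p)"
    by (intro surj_card_le)
  moreover have "card ?I = (\<Prod>i = 0..<m. n - m - i)"
    using card_inj_on_subset_funcset[of B "{1..n} - B" B] B BS by (simp add: card_Diff_subset)
  ultimately show ?thesis by simp
qed

text \<open>
  Twelve moved points give four with the disjointness property of the previous estimate, hence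
  at least \<open>(n - 4) * (n - 5) * (n - 6) * (n - 7)\<close> conjugates. This exceeds \<open>n ^ 3\<close> once \<open>n \<ge> 17\<close>.
\<close>

lemma card_moved_of_small_conjugacy_class:
  assumes p: "p \<in> carrier (alt_group n)" and n: "n \<ge> 17"
    and small: "card (conjugacy_class (alt_group n) p) \<le> n ^ 3"
  shows "card (moved p) < 12"
proof (rule ccontr)
  assume "\<not> card (moved p) < 12"
  then have "card (conjugacy_class (alt_group n) p) \<ge> (\<Prod>i = 0..<4. n - 4 - i)"
    using n by (intro card_conjugacy_class_ge[OF p]) auto
  moreover have "n ^ 3 < (\<Prod>i = 0..<4. n - 4 - i)"
  proof -
    obtain m where m: "n = m + 17"
      using n by (metis le_add_diff_inverse2)
    have "(m + 17) ^ 3 < (m + 13) * ((m + 12) * ((m + 11) * (m + 10)))"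
      by (simp add: power3_eq_cube algebra_simps)
    moreover have "(\<Prod>i = 0..<4. g i) = g 0 * (g 1 * (g 2 * g 3))" for g :: "nat \<Rightarrow> nat"
      by (simp add: numeral_eq_Suc)
    ultimately show ?thesis
      by (simp add: m add.commute)
  qed
  ultimately show False using small by linarith
qed


section \<open>Products of word values\<close>

lemma moved_inv_alt_group:
  "p \<in> carrier (alt_group n) \<Longrightarrow> moved (inv\<^bsub>alt_group n\<^esub> p) = moved p"
  by (simp add: alt_group_inv_equality moved_inv alt_group_bij)

lemma finite_moved: "p \<in> carrier (alt_group n) \<Longrightarrow> finite (moved p)"
  using moved_subset[of p "{1..n}"] finite_subset by (auto simp: alt_group_carrier)

lemma card_moved_prod_set:
  assumes S: "\<And>s. s \<in> S \<Longrightarrow> s \<in> carrier (alt_group n) \<and> card (moved s) \<le> m"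
    and p: "p \<in> prod_set (alt_group n) S k"
  shows "card (moved p) \<le> k * m"
proof -
  obtain ss where ss: "length ss = k" "set ss \<subseteq> S" "p = foldr (\<circ>) ss id"
    using p by (auto simp: prod_set_def alt_group_mult alt_group_one)
  have "finite (moved (foldr (\<circ>) ss id)) \<and> card (moved (foldr (\<circ>) ss id)) \<le> length ss * m"
    using ss(2)
  proof (induction ss)
    case Nil
    show ?case by (simp add: moved_def)
  next
    case (Cons s ss)
    let ?q = "foldr (\<circ>) ss id"
    have s: "finite (moved s)" "card (moved s) \<le> m"
      using S[of s] Cons.prems finite_moved[of s n] by auto
    have q: "finite (moved ?q) \<and> card (moved ?q) \<le> length ss * m"
      using Cons.prems by (intro Cons.IH) simp
    have sub: "moved (s \<circ> ?q) \<subseteq> moved s \<union> moved ?q"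
      by (rule moved_comp)
    have "card (moved (s \<circ> ?q)) \<le> card (moved s \<union> moved ?q)"
      using s q by (intro card_mono[OF _ sub]) simp
    also have "\<dots> \<le> card (moved s) + card (moved ?q)"
      by (rule card_Un_le)
    finally have "card (moved (s \<circ> ?q)) \<le> length (s # ss) * m"
      using s q by simp
    moreover have "finite (moved (s \<circ> ?q))"
      using s q by (intro finite_subset[OF sub]) simp
    moreover have "foldr (\<circ>) (s # ss) id = s \<circ> ?q"
      by (simp only: foldr.simps o_apply)
    ultimately show ?case by (simp only:)
  qed
  then show ?thesis
    by (simp only: ss(1,3))
qed

text \<open>
  The shift \<open>x \<mapsto> x + 1\<close> on all but the last two points extends to an even permutation.
\<close>

lemma exists_even_permutation_moving_most_points:
  "\<exists>p \<in> carrier (alt_group n). n - 2 \<le> card (moved p)"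
proof (cases "n \<ge> 2")
  case True
  obtain p where p: "p \<in> carrier (alt_group n)" "\<And>x. x \<in> {1..n - 2} \<Longrightarrow> p x = Suc x"
    by (rule alt_group_extend[of "{1..n - 2}" n Suc]) (use True in auto)
  have "{1..n - 2} \<subseteq> moved p"
    using p(2) by (auto simp: moved_def)
  then have "card {1..n - 2} \<le> card (moved p)"
    using finite_moved[OF p(1)] by (rule card_mono[rotated])
  then show ?thesis using p(1) by auto
next
  case False
  then show ?thesis
    using alt_group_is_group[of n] group.is_monoid monoid.one_closed by fastforce
qed

text \<open>
  The summand 17 is for the estimate of conjugacy classes; it also leaves more than \<open>12 * k\<close> points
  among the \<open>n - 2\<close> that some even permutation moves.
\<close>

theorem alt_group_word_width:
  assumes n: "n \<ge> 12 * k + 17"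
  shows "\<exists>(d :: nat) w. w \<in> carrier (free_group {1..d}) \<and>
           word_values (alt_group n) {1..d} w \<noteq> {\<one>\<^bsub>alt_group n\<^esub>} \<and>
           \<not> carrier (alt_group n) \<subseteq> prod_set (alt_group n) (word_values (alt_group n) {1..d} w) k"
proof -
  let ?G = "alt_group n"
  have simple: "simple_group ?G"
    using n by (intro alt_group_simple) simp
  have noncomm: "\<not> comm_group ?G"
    using n by (intro alt_group_not_comm) simp
  define c where "c = cycle_of_list [1, 2, 3 :: nat]"
  have c: "c \<in> three_cycles n"
    unfolding c_def using n by (intro CollectI exI[of _ "[1, 2, 3]"]) auto
  then have cG: "c \<in> carrier ?G"
    using three_cycles_incl by blast
  have "c 1 \<noteq> 1"
    by (simp add: c_def transpose_def)
  then have c_ne: "c \<noteq> \<one>\<^bsub>?G\<^esub>"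
    by (auto simp: alt_group_one)
  obtain d w g\<^sub>0 where w: "w \<in> carrier (free_group {1..d::nat})"
    and g\<^sub>0: "g\<^sub>0 \<in> {1..d} \<rightarrow> carrier ?G" "word_val ?G g\<^sub>0 w = c"
    and vals: "\<forall>g \<in> {1..d} \<rightarrow> carrier ?G. word_val ?G g w = \<one>\<^bsub>?G\<^esub> \<or>
        (\<exists>\<beta> \<in> iso ?G ?G. \<beta> (word_val ?G g w) = c)"
    using simple_group.word_with_values_in_one_automorphism_orbit[OF simple noncomm finite_carrier_alt_group cG] by blast
  let ?S = "word_values ?G {1..d} w"
  have "c \<in> ?S"
    using g\<^sub>0 unfolding word_values_def by blast
  then have "?S \<noteq> {\<one>\<^bsub>?G\<^esub>}"
    using c_ne by blast
  moreover have S: "s \<in> carrier ?G \<and> card (moved s) \<le> 12" if s_mem: "s \<in> ?S" for s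
  proof -
    obtain g where g: "g \<in> {1..d} \<rightarrow> carrier ?G"
      and s: "s = word_val ?G g w \<or> s = inv\<^bsub>?G\<^esub> word_val ?G g w"
      using s_mem unfolding word_values_def by blast
    define v where "v = word_val ?G g w"
    have vG: "v \<in> carrier ?G"
      unfolding v_def using w
      by (intro group.word_val_closed[OF alt_group_is_group g]) (simp add: free_group_def)
    have "v = \<one>\<^bsub>?G\<^esub> \<or> (\<exists>\<beta> \<in> iso ?G ?G. \<beta> v = c)"
      unfolding v_def using vals g by blast
    then have "card (moved v) \<le> 12"
    proof
      assume "v = \<one>\<^bsub>?G\<^esub>"
      then show ?thesis by (simp add: alt_group_one moved_def)
    next
      assume "\<exists>\<beta> \<in> iso ?G ?G. \<beta> v = c"
      then obtain \<beta> where \<beta>: "\<beta> \<in> iso ?G ?G" "\<beta> v = c" by blast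
      have "card (conjugacy_class ?G v) \<le> n ^ 3"
        using card_conjugacy_class_iso[OF alt_group_is_group alt_group_is_group \<beta>(1) vG] \<beta>(2)
          card_conjugacy_class_three_cycle[OF c] by simp
      then show ?thesis
        using card_moved_of_small_conjugacy_class[OF vG] n by simp
    qed
    moreover have "s \<in> carrier ?G" "moved s = moved v"
      using s vG moved_inv_alt_group[OF vG] group.inv_closed[OF alt_group_is_group vG]
      by (auto simp: v_def)
    ultimately show ?thesis by simp
  qed
  obtain p where p: "p \<in> carrier ?G" "n - 2 \<le> card (moved p)"
    using exists_even_permutation_moving_most_points by blast
  have "p \<notin> prod_set ?G ?S k"
  proof
    assume p_prod: "p \<in> prod_set ?G ?S k"
    have "card (moved p) \<le> k * 12"
      by (rule card_moved_prod_set[where S = ?S and n = n]) (use S p_prod in blast)+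
    then show False using p(2) n by simp
  qed
  then show ?thesis
    using w \<open>?S \<noteq> {\<one>\<^bsub>?G\<^esub>}\<close> p(1) by blast
qed

section \<open>Word values and isomorphisms\<close>

lemma word_val_iso:
  assumes "group_hom G H f" "g \<in> A \<rightarrow> carrier G" "set w \<subseteq> A \<times> UNIV"
  shows "word_val H (f \<circ> g) w = f (word_val G g w)"
proof -
  interpret group_hom G H f by (rule assms(1))
  have "letter_val H (f \<circ> g) a = f (letter_val G g a)" if "a \<in> A \<times> UNIV" for a
    using that assms(2) by (auto simp: letter_val_def Pi_iff)
  moreover have "word_val G g v \<in> carrier G" if "set v \<subseteq> A \<times> UNIV" for v
    using G.word_val_closed[OF assms(2) that] .
  ultimately show ?thesis
    using assms(3) G.letter_val_closed[OF assms(2)]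
    by (induction w) (auto simp: word_val_def)
qed

lemma word_values_iso:
  assumes "group G" "group H" and f: "f \<in> iso G H" and w: "set w \<subseteq> A \<times> UNIV"
  shows "word_values H A w = f ` word_values G A w"
proof -
  interpret group_hom G H f
    using assms by (simp add: group_hom_def group_hom_axioms_def iso_iff)
  have surj: "f ` carrier G = carrier H"
    using f by (simp add: Group.iso_iff)
  have val: "{word_val H (f \<circ> g) w, inv\<^bsub>H\<^esub> word_val H (f \<circ> g) w}
      = f ` {word_val G g w, inv\<^bsub>G\<^esub> word_val G g w}" if "g \<in> A \<rightarrow> carrier G" for g
    using word_val_iso[OF group_hom_axioms that w] G.word_val_closed[OF that w] by simp
  show ?thesis
  proof
    show "f ` word_values G A w \<subseteq> word_values H A w"
    proof -
      have "f ` {word_val G g w, inv\<^bsub>G\<^esub> word_val G g w} \<subseteq> word_values H A w"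
        if g: "g \<in> A \<rightarrow> carrier G" for g
      proof -
        have "f \<circ> g \<in> A \<rightarrow> carrier H"
          using g by (simp add: Pi_iff)
        then show ?thesis
          unfolding val[OF g, symmetric] word_values_def by (rule UN_upper)
      qed
      then show ?thesis
        by (auto simp: word_values_def[of G])
    qed
    show "word_values H A w \<subseteq> f ` word_values G A w"
    proof
      fix y assume "y \<in> word_values H A w"
      then obtain g where g: "g \<in> A \<rightarrow> carrier H"
        and y: "y \<in> {word_val H g w, inv\<^bsub>H\<^esub> word_val H g w}"
        unfolding word_values_def by blast
      define g' where "g' = inv_into (carrier G) f \<circ> g"
      have g': "g' \<in> A \<rightarrow> carrier G"
        using g surj by (auto simp: g'_def inv_into_into Pi_iff)
      have "word_val H g w = word_val H (f \<circ> g') w"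
        using g surj w by (intro word_val_cong[of A]) (auto simp: g'_def f_inv_into_f Pi_iff)
      then have "y \<in> f ` {word_val G g' w, inv\<^bsub>G\<^esub> word_val G g' w}"
        using y val[OF g'] by simp
      then show "y \<in> f ` word_values G A w"
        using g' unfolding word_values_def by blast
    qed
  qed
qed

lemma prod_set_hom_image_subset:
  assumes "group_hom G H f" "S \<subseteq> carrier G"
  shows "prod_set H (f ` S) k \<subseteq> f ` prod_set G S k"
proof
  interpret group_hom G H f by (rule assms(1))
  fix y assume "y \<in> prod_set H (f ` S) k"
  then obtain ys where ys: "length ys = k" "set ys \<subseteq> f ` S" "y = foldr (\<otimes>\<^bsub>H\<^esub>) ys \<one>\<^bsub>H\<^esub>"
    unfolding prod_set_def by blast
  have "ys \<in> map f ` lists S"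
    using ys(2) unfolding lists_image[symmetric] by (simp add: in_lists_conv_set subset_iff)
  then obtain xs where xs: "set xs \<subseteq> S" "ys = map f xs"
    by auto
  have "set xs \<subseteq> carrier G"
    using xs(1) assms(2) by blast
  then have "foldr (\<otimes>\<^bsub>G\<^esub>) xs \<one>\<^bsub>G\<^esub> \<in> carrier G \<and>
      foldr (\<otimes>\<^bsub>H\<^esub>) (map f xs) \<one>\<^bsub>H\<^esub> = f (foldr (\<otimes>\<^bsub>G\<^esub>) xs \<one>\<^bsub>G\<^esub>)"
    by (induction xs) auto
  then show "y \<in> f ` prod_set G S k"
    using ys xs unfolding prod_set_def by auto
qed

section \<open>Unbounded word width\<close>

theorem theorem1:
  fixes k :: nat
  assumes "k \<ge> 1"
  shows "\<exists>(d :: nat) (w :: nat letter list) (G :: nat monoid).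
           w \<in> carrier (free_group {1..d}) \<and>
           simple_group G \<and> finite (carrier G) \<and>
           word_values G {1..d} w \<noteq> {\<one>\<^bsub>G\<^esub>} \<and>
           carrier G \<noteq> prod_set G (word_values G {1..d} w) k"
proof -
  define n where "n = 12 * k + 17"
  let ?A = "alt_group n"
  obtain d w where w: "w \<in> carrier (free_group {1..d::nat})"
    and nontriv: "word_values ?A {1..d} w \<noteq> {\<one>\<^bsub>?A\<^esub>}"
    and width: "\<not> carrier ?A \<subseteq> prod_set ?A (word_values ?A {1..d} w) k"
    using alt_group_word_width[of k n] by (auto simp: n_def)
  have A: "simple_group ?A" "group ?A"
    by (auto simp: n_def alt_group_is_group intro: alt_group_simple)
  obtain f :: "(nat \<Rightarrow> nat) \<Rightarrow> nat" where inj: "inj_on f (carrier ?A)"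
    using finite_imp_inj_to_nat_seg[OF finite_carrier_alt_group] by blast
  \<comment> \<open>A copy of the alternating group whose elements are natural numbers.\<close>
  define G where "G = image_group f ?A"
  have f: "f \<in> iso ?A G"
    unfolding G_def using inj by (rule inj_imp_image_group_iso)
  have G: "group G"
    unfolding G_def using group.inj_imp_image_group_is_group[OF A(2) inj] .
  interpret f: group_hom ?A G f
    using A(2) G f by (simp add: group_hom_def group_hom_axioms_def Group.iso_iff)
  have surj: "carrier G = f ` carrier ?A"
    by (simp add: G_def image_group_carrier)
  let ?S = "word_values ?A {1..d} w" and ?T = "word_values G {1..d} w"
  have sub: "set w \<subseteq> {1..d} \<times> UNIV"
    using w by (simp add: free_group_def)
  have T: "?T = f ` ?S"
    using word_values_iso[OF A(2) G f sub] .
  have S: "?S \<subseteq> carrier ?A"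
    using f.G.word_val_closed[OF _ sub] by (auto simp: word_values_def)
  have "\<exists>s \<in> ?S. s \<noteq> \<one>\<^bsub>?A\<^esub>"
    using nontriv by (auto simp: word_values_def)
  then have "?T \<noteq> {\<one>\<^bsub>G\<^esub>}"
    unfolding T using S inj f.hom_one by (metis f.G.one_closed image_eqI inj_onD singletonD subsetD)
  moreover have "carrier G \<noteq> prod_set G ?T k"
  proof
    assume eq: "carrier G = prod_set G ?T k"
    obtain p where p: "p \<in> carrier ?A" "p \<notin> prod_set ?A ?S k"
      using width by blast
    have "f p \<in> f ` prod_set ?A ?S k"
      using prod_set_hom_image_subset[OF f.group_hom_axioms S, of k] p(1) eq T by auto
    moreover have "prod_set ?A ?S k \<subseteq> carrier ?A"
    proof -
      have "foldr (\<otimes>\<^bsub>?A\<^esub>) ss \<one>\<^bsub>?A\<^esub> \<in> carrier ?A" if "set ss \<subseteq> ?S" for ss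
        using that S by (induction ss) auto
      then show ?thesis by (auto simp: prod_set_def)
    qed
    ultimately show False
      using p inj by (simp add: inj_on_image_mem_iff)
  qed
  moreover have "simple_group G"
    using simple_group.iso_simple[OF A(1) G f] .
  moreover have "finite (carrier G)"
    using finite_carrier_alt_group surj by simp
  ultimately show ?thesis
    using w by blast
qed

end
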